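(* Let $\mathcal{D}=(\Omega,\mathcal{B})$ be a simple pliable $4$-hypergraph. Then the following are equivalent: (a) $\pi_{\infty}(\mathcal{D})$ is trivial for all $\infty\in\Omega$; (b) $\mathcal{D}$ is the Boolean quadruple system of order $2^k$ for some $k>0$.
   Context: A $4$-hypergraph is a pair $\mathcal{D}=(\Omega,\mathcal{B})$ where $\Omega$ is a finite set and $\mathcal{B}$ is a finite multiset of $4$-element subsets of $\Omega$, called lines. It is simple if there are no repeated lines, and pliable if, whenever three points are all contained in two lines, the two lines contain exactly the same points. Two points are collinear if some line contains both (any point is collinear with itself). Permutations act on the right, so products are composed left to right. For distinct collinear $x,y\in\Omega$ let $\{x,y,x_i,y_i\}$ ($1\le i\le\lambda$) be the lines containing both $x$ and $y$; the elementary move is $[x,y]:=(x,y)\prod_{i=1}^{\lambda}(x_i,y_i)\in\operatorname{Sym}(\Omega)$, and $[a,a]:=\operatorname{Id}_\Omega$. If $a_{i-1},a_i$ are collinear for $1\le i\le k$, put $[a_0,a_1,\ldots,a_k]:=[a_0,a_1]\cdot[a_1,a_2]\cdots[a_{k-1},a_k]$ (a move sequence). For $\infty\in\Omega$ the hole stabilizer $\pi_\infty(\mathcal{D})\leq\operatorname{Sym}(\Omega)$ is the group of all permutations given by move sequences $[a_0,\ldots,a_k]$ with $a_0=a_k=\infty$. The Boolean quadruple system of order $2^k$ is the $4$-hypergraph $(\Omega,\mathcal{B})$ where $\Omega$ is identified with the set of vectors of $\mathbb{F}_2^k$ and $\mathcal{B}$ consists of all sets of four vectors whose sum is $\underline{0}$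 (each occurring once).
   Formalization: Assumes also that Ω has at least two points and that deleting any one point leaves the remaining points joined by collinear walks; otherwise (a) does not imply (b), e.g. for two lines {1,2,3,4}, {4,5,6,7} on 7 points. *)

theory Defs
  imports
    "HOL-Library.Multiset"
    "HOL-Library.Z2"
    "HOL-Combinatorics.Transposition"
begin

definition four_hypergraph :: "'a set \<Rightarrow> 'a set multiset \<Rightarrow> bool" where
  "four_hypergraph \<Omega> B \<longleftrightarrow> finite \<Omega> \<and> (\<forall>l. l \<in># B \<longrightarrow> l \<subseteq> \<Omega> \<and> card l = 4)"

definition simple_lines :: "'a set multiset \<Rightarrow> bool" where
  "simple_lines B \<longleftrightarrow> (\<forall>l. count B l \<le> 1)"

definition pliable :: "'a set multiset \<Rightarrow> bool" where
  "pliable B \<longleftrightarrow>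
     (\<forall>l m x y z. l \<in># B \<longrightarrow> m \<in># B \<longrightarrow> x \<noteq> y \<longrightarrow> y \<noteq> z \<longrightarrow> x \<noteq> z \<longrightarrow>
        {x, y, z} \<subseteq> l \<longrightarrow> {x, y, z} \<subseteq> m \<longrightarrow> l = m)"

definition collinear :: "'a set \<Rightarrow> 'a set multiset \<Rightarrow> 'a \<Rightarrow> 'a \<Rightarrow> bool" where
  "collinear \<Omega> B x y \<longleftrightarrow>
     x \<in> \<Omega> \<and> y \<in> \<Omega> \<and> (x = y \<or> (\<exists>l. l \<in># B \<and> x \<in> l \<and> y \<in> l))"

text \<open>Permutations of \<open>\<Omega>\<close> are represented by functions on the whole type that fix every
  point outside \<open>\<Omega>\<close>.\<close>

text \<open>The transposition exchanging the two elements of a two-element set.\<close>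

definition swap_pair :: "'a set \<Rightarrow> 'a \<Rightarrow> 'a" where
  "swap_pair S = (THE f. \<exists>u v. u \<noteq> v \<and> S = {u, v} \<and> f = transpose u v)"

text \<open>A list enumerating, with multiplicity, the lines through \<open>x\<close> and \<open>y\<close>. In a pliable
  hypergraph the sets \<open>l - {x, y}\<close> for these lines are pairwise equal or disjoint, so the
  transpositions below commute and the product in \<open>elementary_move\<close> does not depend on the
  chosen enumeration.\<close>

definition lines_through :: "'a set multiset \<Rightarrow> 'a \<Rightarrow> 'a \<Rightarrow> 'a set list" where
  "lines_through B x y = (SOME ls. mset ls = {#l \<in># B. x \<in> l \<and> y \<in> l#})"

definition elementary_move :: "'a set multiset \<Rightarrow> 'a \<Rightarrow> 'a \<Rightarrow> 'a \<Rightarrow> 'a" where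
  "elementary_move B x y =
     (if x = y then id
      else fold (\<lambda>l f. swap_pair (l - {x, y}) \<circ> f) (lines_through B x y) (transpose x y))"

text \<open>Permutations act on the right in the mathematical convention, so the leftmost
  elementary move of a sequence is applied first.\<close>

fun move_sequence :: "'a set multiset \<Rightarrow> 'a list \<Rightarrow> 'a \<Rightarrow> 'a" where
  "move_sequence B (a # b # as) = move_sequence B (b # as) \<circ> elementary_move B a b"
| "move_sequence B _ = id"

definition collinear_walk :: "'a set \<Rightarrow> 'a set multiset \<Rightarrow> 'a \<Rightarrow> 'a \<Rightarrow> 'a list \<Rightarrow> bool" where
  "collinear_walk \<Omega> B a b as \<longleftrightarrow>
     as \<noteq> [] \<and> hd as = a \<and> last as = b \<and> set as \<subseteq> \<Omega> \<and> successively (collinear \<Omega> B) as"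

definition hole_stabilizer :: "'a set \<Rightarrow> 'a set multiset \<Rightarrow> 'a \<Rightarrow> ('a \<Rightarrow> 'a) set" where
  "hole_stabilizer \<Omega> B p = {move_sequence B as | as. collinear_walk \<Omega> B p p as}"

text \<open>After deleting any single point, the collinearity graph is connected. For at least
  three points this is 2-connectedness of the collinearity graph; it also holds for two points
  without lines.\<close>

definition no_cut_point :: "'a set \<Rightarrow> 'a set multiset \<Rightarrow> bool" where
  "no_cut_point \<Omega> B \<longleftrightarrow>
     (\<forall>p\<in>\<Omega>. \<forall>a\<in>\<Omega> - {p}. \<forall>b\<in>\<Omega> - {p}. \<exists>as. collinear_walk \<Omega> B a b as \<and> p \<notin> set as)"

text \<open>Vectors over the two-element field of length \<open>k\<close>, as sequences vanishing from
  position \<open>k\<close> on.\<close>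

definition F2_vectors :: "nat \<Rightarrow> (nat \<Rightarrow> bit) set" where
  "F2_vectors k = {v. \<forall>i\<ge>k. v i = 0}"

definition boolean_lines :: "nat \<Rightarrow> (nat \<Rightarrow> bit) set multiset" where
  "boolean_lines k =
     mset_set {S. S \<subseteq> F2_vectors k \<and> card S = 4 \<and> (\<forall>i<k. (\<Sum>v\<in>S. v i) = 0)}"

text \<open>The identification of the point set with the space of vectors is a bijection carrying
  the multiset of lines to the multiset of Boolean lines.\<close>

definition is_boolean_quadruple_system :: "nat \<Rightarrow> 'a set \<Rightarrow> 'a set multiset \<Rightarrow> bool" where
  "is_boolean_quadruple_system k \<Omega> B \<longleftrightarrow>
     (\<exists>\<phi>. bij_betw \<phi> \<Omega> (F2_vectors k) \<and> image_mset (\<lambda>l. \<phi> ` l) B = boolean_lines k)"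

end

theory Submission
  imports Defs
begin

text \<open>If all hole stabilizers are trivial, the triangle walks \<open>a, b, c, a\<close> show that three
  pairwise collinear points lie on a line. A closed walk through \<open>b\<close> then shows that two
  neighbours \<open>a\<close> and \<open>c\<close> of \<open>b\<close> are collinear if some walk joins them avoiding \<open>b\<close>; as there is
  no cut point, all points are collinear. Now fix a point \<open>e\<close>. The value of \<open>[x, y]\<close> at \<open>z\<close>
  is symmetric in \<open>x\<close>, \<open>y\<close>, \<open>z\<close>, and triviality of the walk \<open>e, x, y, e\<close> says \<open>[x, y] = [e, x] [e, y]\<close>.
  So \<open>x + y\<close>, defined as the image of \<open>y\<close> under \<open>[e, x]\<close>, is the addition of an elementary abelian
  2-group in which the lines are the 4-sets with sum zero. Conversely, in a Boolean system
  \<open>[x, y]\<close> is the translation by \<open>x + y\<close>, and along a closed walk these translations cancel.\<close>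

section \<open>Four-element sets and products of disjoint transpositions\<close>

lemma card_4_witness:
  assumes "card l = 4" "x \<in> l" "y \<in> l" "z \<in> l" "x \<noteq> y" "x \<noteq> z" "y \<noteq> z"
  obtains w where "l = {x, y, z, w}" "w \<noteq> x" "w \<noteq> y" "w \<noteq> z"
proof -
  have "finite l" using assms(1) card.infinite by fastforce
  then have "card (l - {x, y, z}) = 1"
    using assms by (subst card_Diff_subset) auto
  then obtain w where "l - {x, y, z} = {w}" by (auto simp: card_1_singleton_iff)
  then show thesis using assms by (intro that[of w]) auto
qed

lemma card_4_obtain:
  assumes "card l = 4"
  obtains x y z w where "l = {x, y, z, w}" "distinct [x, y, z, w]"
proof -
  have "finite l" using assms card.infinite by fastforce
  then obtain xs where xs: "set xs = l" "distinct xs"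
    using finite_distinct_list by blast
  then have "length xs = 4" using assms distinct_card by fastforce
  then obtain x y z w where "xs = [x, y, z, w]"
    by (auto simp: numeral_eq_Suc length_Suc_conv)
  then show thesis using xs by (intro that[of x y z w]) auto
qed

lemma swap_pair_doubleton:
  assumes "u \<noteq> v"
  shows "swap_pair {u, v} = transpose u v"
  unfolding swap_pair_def
proof (rule the_equality)
  show "\<exists>u' v'. u' \<noteq> v' \<and> {u, v} = {u', v'} \<and> transpose u v = transpose u' v'"
    using assms by blast
  show "f = transpose u v" if "\<exists>u' v'. u' \<noteq> v' \<and> {u, v} = {u', v'} \<and> f = transpose u' v'" for f
    using that by (metis doubleton_eq_iff transpose_commute)
qed

text \<open>Each factor moves only the two points of its own pair. The start \<open>f\<close> is
  arbitrary because the fold accumulates into it.\<close>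

lemma fold_swap_pair_fixed:
  assumes "\<forall>l\<in>set ls. \<exists>u v. u \<noteq> v \<and> g l = {u, v}"
    and "\<forall>l\<in>set ls. f z \<notin> g l"
  shows "fold (\<lambda>l f. swap_pair (g l) \<circ> f) ls f z = f z"
  using assms
proof (induction ls arbitrary: f)
  case (Cons l ls)
  then obtain u v where uv: "u \<noteq> v" "g l = {u, v}" by auto
  then have "(swap_pair (g l) \<circ> f) z = f z"
    using Cons.prems by (simp add: swap_pair_doubleton transpose_def)
  then show ?case using Cons.IH[of "swap_pair (g l) \<circ> f"] Cons.prems by simp
qed simp

text \<open>By disjointness only the factor of \<open>l\<close> touches \<open>f z\<close> or
  \<open>w\<close>: the factors before it fix \<open>f z\<close>, and those after it fix
  \<open>w\<close>.\<close>

lemma fold_swap_pair_moved: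
  assumes ls: "\<forall>l\<in>set ls. \<exists>u v. u \<noteq> v \<and> g l = {u, v}" "distinct ls"
    and disj: "\<forall>l\<in>set ls. \<forall>m\<in>set ls. l \<noteq> m \<longrightarrow> g l \<inter> g m = {}"
    and l: "l \<in> set ls" "g l = {f z, w}" "w \<noteq> f z"
  shows "fold (\<lambda>l f. swap_pair (g l) \<circ> f) ls f z = w"
proof -
  let ?s = "\<lambda>l f. swap_pair (g l) \<circ> f"
  obtain ls1 ls2 where split: "ls = ls1 @ l # ls2" using l(1) split_list by metis
  have other: "\<forall>m\<in>set ls1 \<union> set ls2. f z \<notin> g m \<and> w \<notin> g m"
  proof
    fix m assume m: "m \<in> set ls1 \<union> set ls2"
    then have "m \<noteq> l" "m \<in> set ls" using ls(2) split by auto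
    then have "g l \<inter> g m = {}" using disj l(1) by blast
    then show "f z \<notin> g m \<and> w \<notin> g m" using l(2) by auto
  qed
  have 1: "fold ?s ls1 f z = f z"
    by (rule fold_swap_pair_fixed) (use ls other split in auto)
  then have 2: "(swap_pair (g l) \<circ> fold ?s ls1 f) z = w"
    using l swap_pair_doubleton[of "f z" w] by (simp add: transpose_def)
  have "fold ?s ls2 (swap_pair (g l) \<circ> fold ?s ls1 f) z = (swap_pair (g l) \<circ> fold ?s ls1 f) z"
    by (rule fold_swap_pair_fixed) (use ls other split 2 in auto)
  then show ?thesis using 2 split by simp
qed

section \<open>Move sequences and arithmetic of bits\<close>

lemma collinear_sym: "collinear \<Omega> B x y \<Longrightarrow> collinear \<Omega> B y x"
  by (auto simp: collinear_def)

lemma move_sequence_append: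
  "move_sequence B (xs @ y # ys) = move_sequence B (y # ys) \<circ> move_sequence B (xs @ [y])"
proof (induction xs rule: induct_list012)
  case (2 x)
  then show ?case by (cases ys) auto
qed (auto simp: comp_assoc)

lemma move_sequence_fixed:
  "successively (\<lambda>x y. elementary_move B x y z = z) xs \<Longrightarrow> move_sequence B xs z = z"
  by (induction xs rule: induct_list012) auto

lemma bit_sum_eq_0_iff: "(a :: bit) + (b + (c + d)) = 0 \<longleftrightarrow> d = a + b + c"
  by (cases a; cases b; cases c; cases d) simp_all

lemma bit_add_eq_0_iff: "(a :: bit) + b = 0 \<longleftrightarrow> a = b"
  by (cases a; cases b) simp_all

lemma bit_sum_cancel:
  shows "(a :: bit) = a + b + c \<longleftrightarrow> b = c"
    and "b = a + b + c \<longleftrightarrow> a = c"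
    and "c = a + b + c \<longleftrightarrow> a = b"
  by (cases a; cases b; cases c; simp)+

lemma bit_sum_collapse:
  shows "(a :: bit) + a + c = c"
    and "a + b + a = b"
    and "a + b + b = a"
  by (cases a; cases b; cases c; simp)+

lemma bit_sum_telescope: "(b :: bit) + c + (a + b + d) = a + c + d"
  by (cases a; cases b; cases c; cases d) simp_all

text \<open>This rule would replace sums by case distinctions.\<close>

declare add_bit_eq_xor [simp del]

section \<open>Elementary moves in simple pliable hypergraphs\<close>

locale pliable_hypergraph =
  fixes \<Omega> :: "'a set" and B :: "'a set multiset"
  assumes hypergraph: "four_hypergraph \<Omega> B"
    and simple: "simple_lines B"
    and pliable: "pliable B"
begin

abbreviation "col \<equiv> collinear \<Omega> B"
abbreviation "em \<equiv> elementary_move B"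

lemma finite_points: "finite \<Omega>"
  using hypergraph by (simp add: four_hypergraph_def)

lemma line_subset: "l \<in># B \<Longrightarrow> l \<subseteq> \<Omega>"
  using hypergraph by (simp add: four_hypergraph_def)

lemma card_line: "l \<in># B \<Longrightarrow> card l = 4"
  using hypergraph by (simp add: four_hypergraph_def)

lemma line_unique:
  "\<lbrakk>l \<in># B; m \<in># B; x \<noteq> y; y \<noteq> z; x \<noteq> z; {x, y, z} \<subseteq> l; {x, y, z} \<subseteq> m\<rbrakk> \<Longrightarrow> l = m"
  using pliable[unfolded pliable_def, rule_format, of l m x y z] by simp

text \<open>Simplicity bounds every count by one. Equalities between multisets of lines can then be
  decided on the underlying sets.\<close>

lemma mset_set_lines: "B = mset_set (set_mset B)"
proof (rule multiset_eqI)
  fix l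
  have "count B l \<le> 1" using simple by (simp add: simple_lines_def)
  then show "count B l = count (mset_set (set_mset B)) l"
    using count_greater_zero_iff[of B l]
    by (cases "l \<in># B") (auto simp: not_in_iff simp del: count_greater_zero_iff)
qed

text \<open>Every multiset has an enumeration, so the choice in \<open>lines_through\<close> is
  meaningful; simplicity excludes repetitions in it.\<close>

lemma lines_through_props:
  shows "set (lines_through B x y) = {l. l \<in># B \<and> x \<in> l \<and> y \<in> l}" (is ?set)
    and "distinct (lines_through B x y)" (is ?distinct)
proof -
  have "\<exists>ls. mset ls = {#l \<in># B. x \<in> l \<and> y \<in> l#}" by (rule ex_mset)
  then have mset: "mset (lines_through B x y) = {#l \<in># B. x \<in> l \<and> y \<in> l#}"
    unfolding lines_through_def by (rule someI_ex)
  then have "set_mset (mset (lines_through B x y)) = {l. l \<in># B \<and> x \<in> l \<and> y \<in> l}"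
    by auto
  then show ?set by simp
  have "mset (lines_through B x y) = mset_set {l \<in> set_mset B. x \<in> l \<and> y \<in> l}"
    unfolding mset by (subst mset_set_lines) (simp add: filter_mset_mset_set)
  moreover have "set (lines_through B x y) = {l \<in> set_mset B. x \<in> l \<and> y \<in> l}"
    using \<open>?set\<close> by auto
  ultimately show ?distinct
    by (simp add: distinct_count_atmost_1)
qed

lemma lines_through_pairs:
  assumes "x \<noteq> y"
  shows "\<forall>l\<in>set (lines_through B x y). \<exists>u v. u \<noteq> v \<and> l - {x, y} = {u, v}"
proof
  fix l assume "l \<in> set (lines_through B x y)"
  then have l: "l \<in># B" "x \<in> l" "y \<in> l" by (auto simp: lines_through_props)
  have "finite l" using card_line[OF l(1)] card.infinite by fastforce
  then have "card (l - {x, y}) = 2"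
    using assms l card_line by (subst card_Diff_subset) auto
  then show "\<exists>u v. u \<noteq> v \<and> l - {x, y} = {u, v}" by (auto simp: card_2_iff)
qed

lemma elementary_move_fixed:
  assumes "z \<noteq> x" "z \<noteq> y" "\<not> (\<exists>l. l \<in># B \<and> {x, y, z} \<subseteq> l)"
  shows "em x y z = z"
proof (cases "x = y")
  case False
  have "fold (\<lambda>l f. swap_pair (l - {x, y}) \<circ> f) (lines_through B x y) (transpose x y) z
      = transpose x y z"
    by (rule fold_swap_pair_fixed[OF lines_through_pairs[OF False]])
      (use assms in \<open>auto simp: lines_through_props\<close>)
  then show ?thesis using False assms by (simp add: elementary_move_def)
qed (simp add: elementary_move_def)

lemma elementary_move_left [simp]: "em x y x = y"
proof (cases "x = y")
  case False
  have "fold (\<lambda>l f. swap_pair (l - {x, y}) \<circ> f) (lines_through B x y) (transpose x y) x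
      = transpose x y x"
    by (rule fold_swap_pair_fixed[OF lines_through_pairs[OF False]]) auto
  then show ?thesis using False by (simp add: elementary_move_def)
qed (simp add: elementary_move_def)

lemma elementary_move_right [simp]: "em x y y = x"
proof (cases "x = y")
  case False
  have "fold (\<lambda>l f. swap_pair (l - {x, y}) \<circ> f) (lines_through B x y) (transpose x y) y
      = transpose x y y"
    by (rule fold_swap_pair_fixed[OF lines_through_pairs[OF False]]) auto
  then show ?thesis using False by (simp add: elementary_move_def)
qed (simp add: elementary_move_def)

lemma elementary_move_same [simp]: "em x x z = z"
  by (simp add: elementary_move_def)

text \<open>By pliability, two lines through \<open>x\<close> and \<open>y\<close> with a further
  common point are equal. The pairs \<open>l - {x, y}\<close> are therefore disjoint, and only
  \<open>{z, w}\<close> acts on \<open>z\<close>.\<close>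

lemma elementary_move_line:
  assumes l: "{x, y, z, w} \<in># B" and d: "distinct [x, y, z, w]"
  shows "em x y z = w"
proof -
  have xy: "x \<noteq> y" using d by auto
  have "fold (\<lambda>l f. swap_pair (l - {x, y}) \<circ> f) (lines_through B x y) (transpose x y) z = w"
  proof (rule fold_swap_pair_moved[OF lines_through_pairs[OF xy] lines_through_props(2)])
    show "\<forall>l\<in>set (lines_through B x y). \<forall>m\<in>set (lines_through B x y).
        l \<noteq> m \<longrightarrow> (l - {x, y}) \<inter> (m - {x, y}) = {}"
    proof (intro ballI impI, rule ccontr)
      fix l m
      assume lm: "l \<in> set (lines_through B x y)" "m \<in> set (lines_through B x y)" "l \<noteq> m"
        "(l - {x, y}) \<inter> (m - {x, y}) \<noteq> {}"
      then obtain v where "v \<in> l" "v \<in> m" "v \<noteq> x" "v \<noteq> y" by blast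
      then show False
        using line_unique[of l m x y v] xy lm by (auto simp: lines_through_props)
    qed
    show "{x, y, z, w} \<in> set (lines_through B x y)" using l by (simp add: lines_through_props)
    show "{x, y, z, w} - {x, y} = {transpose x y z, w}" "w \<noteq> transpose x y z"
      using d by auto
  qed
  then show ?thesis using xy by (simp add: elementary_move_def)
qed

lemma elementary_move_outside:
  assumes "x \<in> \<Omega>" "y \<in> \<Omega>" "z \<notin> \<Omega>"
  shows "em x y z = z"
  using assms line_subset by (intro elementary_move_fixed) auto

lemma line_collinear: "\<lbrakk>l \<in># B; x \<in> l; y \<in> l\<rbrakk> \<Longrightarrow> col x y"
  using line_subset unfolding collinear_def by blast

section \<open>Boolean systems have trivial hole stabilizers\<close>

text \<open>As lines are not repeated and \<phi> is injective, equality of the multisets reduces to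
  a test on single 4-sets. Both implications of the theorem use this form.\<close>

lemma boolean_iff_lines:
  assumes bij: "bij_betw \<phi> \<Omega> (F2_vectors k)"
  shows "image_mset (\<lambda>l. \<phi> ` l) B = boolean_lines k \<longleftrightarrow>
    (\<forall>l. l \<subseteq> \<Omega> \<longrightarrow> card l = 4 \<longrightarrow> (l \<in># B \<longleftrightarrow> (\<forall>i. (\<Sum>v\<in>l. \<phi> v i) = 0)))"
    (is "?eq \<longleftrightarrow> ?char")
proof -
  define T where "T = {S. S \<subseteq> F2_vectors k \<and> card S = 4 \<and> (\<forall>i<k. (\<Sum>v\<in>S. v i) = 0)}"
  have inj: "inj_on \<phi> \<Omega>" and img: "\<phi> ` \<Omega> = F2_vectors k"
    using bij by (auto simp: bij_betw_def)
  have inj_img: "inj_on (\<lambda>l. \<phi> ` l) (Pow \<Omega>)"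
    using inj by (auto simp: inj_on_def inj_on_image_eq_iff[OF inj])
  have "set_mset B \<subseteq> Pow \<Omega>" using line_subset by auto
  then have "image_mset (\<lambda>l. \<phi> ` l) B = mset_set ((\<lambda>l. \<phi> ` l) ` set_mset B)"
    by (subst mset_set_lines, intro image_mset_mset_set inj_on_subset[OF inj_img])
  moreover have "finite (F2_vectors k)" using finite_points img by (metis finite_imageI)
  then have "finite T" by (auto simp: T_def intro: finite_subset[of _ "Pow (F2_vectors k)"])
  ultimately have "?eq \<longleftrightarrow> (\<lambda>l. \<phi> ` l) ` set_mset B = T"
    unfolding boolean_lines_def T_def[symmetric] by (simp add: mset_set_eq_iff)
  moreover have image_S: "\<phi> ` l \<in> T \<longleftrightarrow> card l = 4 \<and> (\<forall>i. (\<Sum>v\<in>l. \<phi> v i) = 0)"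
    if l: "l \<subseteq> \<Omega>" for l
  proof -
    have inj_l: "inj_on \<phi> l" using inj l inj_on_subset by blast
    \<comment> \<open>Coordinates from \<open>k\<close> on vanish, so the sum condition may range
      over all \<open>i\<close>, as comparing whole functions requires.\<close>
    have *: "(\<Sum>v\<in>l. \<phi> v i) = 0" if "\<not> i < k" for i
    proof (intro sum.neutral ballI)
      fix v assume "v \<in> l"
      then have "\<phi> v \<in> F2_vectors k" using l img by blast
      then show "\<phi> v i = 0" using that by (simp add: F2_vectors_def)
    qed
    have "\<phi> ` l \<in> T \<longleftrightarrow> card l = 4 \<and> (\<forall>i<k. (\<Sum>v\<in>l. \<phi> v i) = 0)"
      using l img inj_l by (auto simp: T_def card_image sum.reindex)
    then show ?thesis using * by blast
  qed
  moreover have "(\<lambda>l. \<phi> ` l) ` set_mset B = T \<longleftrightarrow> ?char"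
  proof
    assume eq: "(\<lambda>l. \<phi> ` l) ` set_mset B = T"
    show ?char
    proof (intro allI impI)
      fix l assume l: "l \<subseteq> \<Omega>" "card l = 4"
      have "l \<in># B \<longleftrightarrow> \<phi> ` l \<in> (\<lambda>l. \<phi> ` l) ` set_mset B"
        by (rule inj_on_image_mem_iff[OF inj_img, symmetric]) (use l line_subset in auto)
      then show "l \<in># B \<longleftrightarrow> (\<forall>i. (\<Sum>v\<in>l. \<phi> v i) = 0)"
        unfolding eq image_S[OF l(1)] using l(2) by simp
    qed
  next
    assume char: ?char
    show "(\<lambda>l. \<phi> ` l) ` set_mset B = T"
    proof (intro equalityI subsetI)
      fix S assume "S \<in> (\<lambda>l. \<phi> ` l) ` set_mset B"
      then obtain l where l: "l \<in># B" "S = \<phi> ` l" by auto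
      then have "l \<subseteq> \<Omega>" "card l = 4" by (auto intro: card_line dest: line_subset)
      then show "S \<in> T" using l char image_S[of l] by simp
    next
      fix S assume S: "S \<in> T"
      then have "S \<subseteq> \<phi> ` \<Omega>" using img by (simp add: T_def)
      then obtain l where l: "l \<subseteq> \<Omega>" "S = \<phi> ` l" by (auto simp: subset_image_iff)
      then have "l \<in># B" using S char image_S[of l] by simp
      then show "S \<in> (\<lambda>l. \<phi> ` l) ` set_mset B" using l by blast
    qed
  qed
  ultimately show ?thesis by simp
qed

lemma boolean_line_iff:
  assumes bij: "bij_betw \<phi> \<Omega> (F2_vectors k)"
    and lines: "image_mset (\<lambda>l. \<phi> ` l) B = boolean_lines k"
    and "{x, y, z, w} \<subseteq> \<Omega>" and d: "distinct [x, y, z, w]"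
  shows "{x, y, z, w} \<in># B \<longleftrightarrow> (\<forall>i. \<phi> w i = \<phi> x i + \<phi> y i + \<phi> z i)"
proof -
  have "(\<Sum>v\<in>{x, y, z, w}. \<phi> v i) = \<phi> x i + (\<phi> y i + (\<phi> z i + \<phi> w i))" for i
    using d by simp
  moreover have "card {x, y, z, w} = 4" using d by simp
  moreover have "\<forall>l. l \<subseteq> \<Omega> \<longrightarrow> card l = 4 \<longrightarrow> (l \<in># B \<longleftrightarrow> (\<forall>i. (\<Sum>v\<in>l. \<phi> v i) = 0))"
    using lines boolean_iff_lines[OF bij] by simp
  ultimately show ?thesis
    using assms(3) by (simp only: bit_sum_eq_0_iff)
qed

text \<open>For distinct points, cancellation shows that the point with this vector differs from all
  three, so it completes them to a line. For repeated points the formula agrees with the evident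
  values of the move.\<close>

lemma boolean_elementary_move:
  assumes bij: "bij_betw \<phi> \<Omega> (F2_vectors k)"
    and lines: "image_mset (\<lambda>l. \<phi> ` l) B = boolean_lines k"
    and xyz: "x \<in> \<Omega>" "y \<in> \<Omega>" "z \<in> \<Omega>"
  shows "em x y z \<in> \<Omega> \<and> \<phi> (em x y z) = (\<lambda>i. \<phi> x i + \<phi> y i + \<phi> z i)"
proof (cases "distinct [x, y, z]")
  case True
  have vec: "\<phi> v \<in> F2_vectors k" if "v \<in> \<Omega>" for v using bij that bij_betwE by blast
  have "(\<lambda>i. \<phi> x i + \<phi> y i + \<phi> z i) \<in> F2_vectors k"
    using xyz[THEN vec] by (simp add: F2_vectors_def)
  then obtain w where w: "w \<in> \<Omega>" "\<phi> w = (\<lambda>i. \<phi> x i + \<phi> y i + \<phi> z i)"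
    using bij by (metis (no_types, lifting) bij_betw_imp_surj_on imageE)
  have inj: "u = v" if "\<phi> u = \<phi> v" "u \<in> \<Omega>" "v \<in> \<Omega>" for u v
    using bij that by (auto simp: bij_betw_def inj_on_def)
  have w_at: "\<phi> w i = \<phi> x i + \<phi> y i + \<phi> z i" for i
    by (simp only: w(2))
  have "w \<noteq> x"
  proof
    assume "w = x"
    then have "\<phi> y i = \<phi> z i" for i using w_at[of i] bit_sum_cancel(1) by metis
    then show False using inj[of y z] xyz True by auto
  qed
  moreover have "w \<noteq> y"
  proof
    assume "w = y"
    then have "\<phi> x i = \<phi> z i" for i using w_at[of i] bit_sum_cancel(2) by metis
    then show False using inj[of x z] xyz True by auto
  qed
  moreover have "w \<noteq> z"
  proof
    assume "w = z"
    then have "\<phi> x i = \<phi> y i" for i using w_at[of i] bit_sum_cancel(3) by metis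
    then show False using inj[of x y] xyz True by auto
  qed
  ultimately have d: "distinct [x, y, z, w]" using True by auto
  then have "{x, y, z, w} \<in># B"
    using boolean_line_iff[OF bij lines _ d] xyz w by simp
  then show ?thesis using elementary_move_line d w by simp
next
  case False
  then consider "x = y" | "x = z" | "y = z" by auto
  then show ?thesis
    using xyz by cases (simp_all add: bit_sum_collapse)
qed

text \<open>The successive translations telescope. Both ends are left free so that the induction can
  drop the first point.\<close>

lemma boolean_move_sequence:
  assumes bij: "bij_betw \<phi> \<Omega> (F2_vectors k)"
    and lines: "image_mset (\<lambda>l. \<phi> ` l) B = boolean_lines k"
    and "xs \<noteq> []" "set xs \<subseteq> \<Omega>" "z \<in> \<Omega>"
  shows "move_sequence B xs z \<in> \<Omega> \<and>
    \<phi> (move_sequence B xs z) = (\<lambda>i. \<phi> (hd xs) i + \<phi> (last xs) i + \<phi> z i)"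
  using assms(3-)
proof (induction xs arbitrary: z rule: induct_list012)
  case (3 x y xs)
  have "em x y z \<in> \<Omega> \<and> \<phi> (em x y z) = (\<lambda>i. \<phi> x i + \<phi> y i + \<phi> z i)"
    using 3 boolean_elementary_move[OF bij lines] by simp
  then show ?case using "3.IH"(2)[of "em x y z"] 3 by (simp add: bit_sum_telescope)
qed (auto simp: bit_sum_collapse)

lemma move_sequence_outside:
  assumes "set xs \<subseteq> \<Omega>" "z \<notin> \<Omega>"
  shows "move_sequence B xs z = z"
  using assms elementary_move_outside by (induction xs rule: induct_list012) auto

lemma boolean_hole_stabilizer:
  assumes "is_boolean_quadruple_system k \<Omega> B" "p \<in> \<Omega>"
  shows "hole_stabilizer \<Omega> B p = {id}"
proof -
  obtain \<phi> where bij: "bij_betw \<phi> \<Omega> (F2_vectors k)"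
    and lines: "image_mset (\<lambda>l. \<phi> ` l) B = boolean_lines k"
    using assms(1) by (auto simp: is_boolean_quadruple_system_def)
  have "move_sequence B xs = id" if xs: "collinear_walk \<Omega> B p p xs" for xs
  proof
    fix z
    show "move_sequence B xs z = id z"
    proof (cases "z \<in> \<Omega>")
      case True
      then have "move_sequence B xs z \<in> \<Omega>" "\<phi> (move_sequence B xs z) = \<phi> z"
        using boolean_move_sequence[OF bij lines, of xs z] xs
        by (auto simp: collinear_walk_def bit_sum_collapse)
      then show ?thesis
        using bij True by (auto simp: bij_betw_def inj_on_def)
    next
      case False
      then show ?thesis using move_sequence_outside xs by (simp add: collinear_walk_def)
    qed
  qed
  \<comment> \<open>The one-point walk realizes the identity, so the stabilizer is not
    empty.\<close>
  moreover have "collinear_walk \<Omega> B p p [p]" using assms(2) by (simp add: collinear_walk_def)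
  ultimately show ?thesis
    unfolding hole_stabilizer_def by (auto intro!: exI[of _ "[p]"])
qed

end

section \<open>Coordinates on finite elementary abelian 2-groups\<close>

lemma F2_vectors_0: "F2_vectors 0 = {\<lambda>i. 0}"
  by (auto simp: F2_vectors_def)

lemma F2_vectors_add:
  "\<lbrakk>u \<in> F2_vectors k; v \<in> F2_vectors k\<rbrakk> \<Longrightarrow> (\<lambda>i. u i + v i) \<in> F2_vectors k"
  by (simp add: F2_vectors_def)

text \<open>Left commutativity stands in for associativity because it is the law that the symmetry
  of the elementary moves yields directly.\<close>

locale elementary_abelian_2_group =
  fixes G :: "'a set" and add :: "'a \<Rightarrow> 'a \<Rightarrow> 'a" and e :: 'a
  assumes finite: "finite G"
    and zero_closed: "e \<in> G"
    and closed: "\<lbrakk>x \<in> G; y \<in> G\<rbrakk> \<Longrightarrow> add x y \<in> G"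
    and comm: "\<lbrakk>x \<in> G; y \<in> G\<rbrakk> \<Longrightarrow> add x y = add y x"
    and left_comm: "\<lbrakk>x \<in> G; y \<in> G; z \<in> G\<rbrakk> \<Longrightarrow> add x (add y z) = add y (add x z)"
    and self: "x \<in> G \<Longrightarrow> add x x = e"
    and left_zero: "x \<in> G \<Longrightarrow> add e x = x"
begin

lemma right_zero: "x \<in> G \<Longrightarrow> add x e = x"
  using comm left_zero zero_closed by metis

lemma assoc: "\<lbrakk>x \<in> G; y \<in> G; z \<in> G\<rbrakk> \<Longrightarrow> add (add x y) z = add x (add y z)"
  using comm left_comm closed by metis

lemma cancel_self: "\<lbrakk>x \<in> G; y \<in> G\<rbrakk> \<Longrightarrow> add x (add x y) = y"
  using assoc[of x x y] self left_zero by simp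

lemma eq_if_add_zero: "\<lbrakk>x \<in> G; y \<in> G; add x y = e\<rbrakk> \<Longrightarrow> x = y"
  using cancel_self right_zero by metis

text \<open>Such a map amounts to \<open>k\<close> linearly independent elements of
  \<open>G\<close>, the images of the unit vectors.\<close>

definition embedding :: "nat \<Rightarrow> ((nat \<Rightarrow> bit) \<Rightarrow> 'a) \<Rightarrow> bool" where
  "embedding k \<psi> \<longleftrightarrow> inj_on \<psi> (F2_vectors k) \<and> \<psi> ` F2_vectors k \<subseteq> G \<and>
     (\<forall>u\<in>F2_vectors k. \<forall>v\<in>F2_vectors k. \<psi> (\<lambda>i. u i + v i) = add (\<psi> u) (\<psi> v))"

text \<open>A basis of the image is extended by \<open>w\<close>, which becomes the image of the
  unit vector at position \<open>k\<close>.\<close>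

lemma embedding_extend:
  assumes emb: "embedding k \<psi>" and w: "w \<in> G" "w \<notin> \<psi> ` F2_vectors k"
  obtains \<psi>' where "embedding (Suc k) \<psi>'" "\<psi> ` F2_vectors k \<subset> \<psi>' ` F2_vectors (Suc k)"
proof -
  \<comment> \<open>\<open>r\<close> erases coordinate \<open>k\<close>, and \<open>t\<close> turns
    the bit at \<open>k\<close> into the matching multiple of \<open>w\<close>.\<close>
  define r :: "(nat \<Rightarrow> bit) \<Rightarrow> nat \<Rightarrow> bit" where "r v = v(k := 0)" for v
  define t where "t b = (if b = (1 :: bit) then w else e)" for b
  define \<psi>' where "\<psi>' v = add (\<psi> (r v)) (t (v k))" for v
  have r: "r v \<in> F2_vectors k" if "v \<in> F2_vectors (Suc k)" for v
    using that by (auto simp: F2_vectors_def r_def)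
  have img: "\<psi> v \<in> G" if "v \<in> F2_vectors k" for v
    using emb that by (auto simp: embedding_def)
  have hom: "\<psi> (\<lambda>i. u i + v i) = add (\<psi> u) (\<psi> v)"
    if "u \<in> F2_vectors k" "v \<in> F2_vectors k" for u v
    using emb that by (simp add: embedding_def)
  have t: "t b \<in> G" for b using w zero_closed by (simp add: t_def)
  have t_add: "t (b + c) = add (t b) (t c)" for b c
    using w zero_closed by (cases b; cases c) (simp_all add: t_def self left_zero right_zero)
  have r_add: "r (\<lambda>i. u i + v i) = (\<lambda>i. r u i + r v i)" for u v
    by (auto simp: r_def)
  have hom': "\<psi>' (\<lambda>i. u i + v i) = add (\<psi>' u) (\<psi>' v)"
    if "u \<in> F2_vectors (Suc k)" "v \<in> F2_vectors (Suc k)" for u v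
    using r[OF that(1)] r[OF that(2)] img t
    by (simp add: \<psi>'_def r_add hom t_add assoc left_comm closed)
  have img': "\<psi>' v \<in> G" if "v \<in> F2_vectors (Suc k)" for v
    using r[OF that] img t closed by (simp add: \<psi>'_def)
  have "inj_on \<psi>' (F2_vectors (Suc k))"
  proof (rule inj_onI)
    fix u v assume u: "u \<in> F2_vectors (Suc k)" and v: "v \<in> F2_vectors (Suc k)"
      and eq: "\<psi>' u = \<psi>' v"
    \<comment> \<open>Additivity reduces injectivity to a trivial kernel; in characteristic two the
      difference of \<open>u\<close> and \<open>v\<close> is their sum.\<close>
    define d where "d = (\<lambda>i. u i + v i)"
    have d: "d \<in> F2_vectors (Suc k)" using u v F2_vectors_add by (simp add: d_def)
    have "\<psi>' d = e" unfolding d_def using hom'[OF u v] eq self img'[OF v] by simp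
    then have "\<psi> (r d) = t (d k)"
      using eq_if_add_zero img r[OF d] t by (auto simp: \<psi>'_def)
    \<comment> \<open>If \<open>d k\<close> were 1, then \<open>w\<close> would lie in the image of
      \<psi>.\<close>
    moreover from this have dk: "d k = 0"
      using w(2) r[OF d] by (cases "d k") (auto simp: t_def)
    moreover have "r d = d" using dk by (auto simp: r_def)
    ultimately have "\<psi> d = e" "d \<in> F2_vectors k" using r[OF d] by (simp_all add: t_def)
    moreover have zero: "(\<lambda>i. 0) \<in> F2_vectors k" by (simp add: F2_vectors_def)
    moreover have "\<psi> (\<lambda>i. 0) = e" using hom[OF zero zero] self img[OF zero] by simp
    ultimately have "d = (\<lambda>i. 0)" using emb unfolding embedding_def inj_on_def by metis
    then have "u i + v i = 0" for i unfolding d_def by (rule fun_cong)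
    then show "u = v" by (simp add: bit_add_eq_0_iff fun_eq_iff)
  qed
  then have "embedding (Suc k) \<psi>'"
    unfolding embedding_def using hom' img' by auto
  moreover have "\<psi> ` F2_vectors k \<subseteq> \<psi>' ` F2_vectors (Suc k)"
  proof
    fix x assume "x \<in> \<psi> ` F2_vectors k"
    then obtain v where v: "v \<in> F2_vectors k" "x = \<psi> v" by auto
    then have "r v = v" "v k = 0" "v \<in> F2_vectors (Suc k)"
      by (auto simp: F2_vectors_def r_def)
    then show "x \<in> \<psi>' ` F2_vectors (Suc k)"
      using v right_zero img by (auto simp: \<psi>'_def t_def intro!: image_eqI[of _ _ v])
  qed
  moreover have "w \<in> \<psi>' ` F2_vectors (Suc k)"
  proof (rule image_eqI)
    let ?v = "(\<lambda>i. 0)(k := 1) :: nat \<Rightarrow> bit"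
    have zero: "(\<lambda>i. 0) \<in> F2_vectors k" by (simp add: F2_vectors_def)
    have "r ?v = (\<lambda>i. 0)" by (auto simp: r_def)
    moreover have "\<psi> (\<lambda>i. 0) = e" using hom[OF zero zero] self img[OF zero] by simp
    ultimately show "w = \<psi>' ?v" using left_zero w by (simp add: \<psi>'_def t_def)
    show "?v \<in> F2_vectors (Suc k)" by (simp add: F2_vectors_def)
  qed
  ultimately show thesis using w(2) that by blast
qed

text \<open>As long as the image is not all of \<open>G\<close>, an extension gains at least one
  element; \<open>n\<close> counts these gains.\<close>

lemma embedding_large:
  "\<exists>k \<psi>. embedding k \<psi> \<and> (\<psi> ` F2_vectors k = G \<or> n \<le> card (\<psi> ` F2_vectors k))"
proof (induction n)
  case 0
  have "embedding 0 (\<lambda>_. e)"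
    using zero_closed self by (simp add: embedding_def F2_vectors_0)
  then show ?case by blast
next
  case (Suc n)
  then obtain k \<psi> where emb: "embedding k \<psi>"
    and alt: "\<psi> ` F2_vectors k = G \<or> n \<le> card (\<psi> ` F2_vectors k)" by auto
  show ?case
  proof (cases "\<psi> ` F2_vectors k = G")
    case False
    then obtain w where "w \<in> G" "w \<notin> \<psi> ` F2_vectors k"
      using emb by (auto simp: embedding_def)
    from embedding_extend[OF emb this] obtain \<psi>'
      where \<psi>': "embedding (Suc k) \<psi>'" "\<psi> ` F2_vectors k \<subset> \<psi>' ` F2_vectors (Suc k)" .
    have "finite (\<psi>' ` F2_vectors (Suc k))"
      using \<psi>'(1) finite finite_subset by (auto simp: embedding_def)
    then have "card (\<psi> ` F2_vectors k) < card (\<psi>' ` F2_vectors (Suc k))"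
      using \<psi>'(2) by (rule psubset_card_mono)
    then show ?thesis using \<psi>'(1) alt False by (intro exI[of _ "Suc k"] exI[of _ \<psi>']) simp
  qed (use emb in blast)
qed

lemma coordinates:
  obtains \<phi> k where "bij_betw \<phi> G (F2_vectors k)"
    "\<forall>x\<in>G. \<forall>y\<in>G. \<phi> (add x y) = (\<lambda>i. \<phi> x i + \<phi> y i)"
proof -
  \<comment> \<open>The bound \<open>Suc (card G)\<close> exceeds the size of any image, which
    leaves only the surjective alternative.\<close>
  obtain k \<psi> where emb: "embedding k \<psi>"
    and "\<psi> ` F2_vectors k = G \<or> Suc (card G) \<le> card (\<psi> ` F2_vectors k)"
    using embedding_large by blast
  moreover have "card (\<psi> ` F2_vectors k) \<le> card G"
    using emb finite by (intro card_mono) (auto simp: embedding_def)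
  ultimately have bij: "bij_betw \<psi> (F2_vectors k) G"
    by (auto simp: embedding_def bij_betw_def)
  define \<phi> where "\<phi> = inv_into (F2_vectors k) \<psi>"
  have bij': "bij_betw \<phi> G (F2_vectors k)"
    unfolding \<phi>_def by (rule bij_betw_inv_into[OF bij])
  have "\<phi> (add x y) = (\<lambda>i. \<phi> x i + \<phi> y i)" if xy: "x \<in> G" "y \<in> G" for x y
  proof -
    have mem: "\<phi> x \<in> F2_vectors k" "\<phi> y \<in> F2_vectors k" using bij' xy bij_betwE by blast+
    have inv: "\<psi> (\<phi> x) = x" "\<psi> (\<phi> y) = y"
      using bij xy by (simp_all add: \<phi>_def bij_betw_inv_into_right)
    have "add x y = \<psi> (\<lambda>i. \<phi> x i + \<phi> y i)"
      using emb mem inv by (simp add: embedding_def)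
    then show ?thesis
      using bij F2_vectors_add[OF mem] by (simp add: \<phi>_def bij_betw_inv_into_left)
  qed
  then show thesis using bij' that by blast
qed

end

section \<open>Collinearity when all hole stabilizers are trivial\<close>

locale trivial_stabilizers = pliable_hypergraph +
  assumes trivial: "p \<in> \<Omega> \<Longrightarrow> hole_stabilizer \<Omega> B p = {id}"
begin

lemma closed_walk_trivial:
  assumes "collinear_walk \<Omega> B p p xs"
  shows "move_sequence B xs = id"
proof -
  have "p \<in> \<Omega>" using assms by (auto simp: collinear_walk_def)
  then show ?thesis using trivial assms unfolding hole_stabilizer_def by blast
qed

lemma triangle_trivial:
  assumes "col a b" "col b c" "col c a"
  shows "em c a (em b c (em a b z)) = z"
proof -
  have "collinear_walk \<Omega> B a a [a, b, c, a]"
    using assms by (auto simp: collinear_walk_def collinear_def)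
  from closed_walk_trivial[OF this] show ?thesis
    by (simp add: fun_eq_iff)
qed

text \<open>If no line contained all three points, \<open>em b c\<close> would fix \<open>a\<close>.
  The closed walk \<open>a, b, c, a\<close> would then send \<open>b\<close> to \<open>a\<close>,
  keep it there, and finally move it to \<open>c\<close>.\<close>

lemma triangle_line:
  assumes "col a b" "col b c" "col c a" and d: "distinct [a, b, c]"
  obtains w where "{a, b, c, w} \<in># B" "distinct [a, b, c, w]"
proof -
  have "\<exists>l. l \<in># B \<and> {b, c, a} \<subseteq> l"
  proof (rule ccontr)
    assume "\<not> ?thesis"
    then have "em b c a = a" using d by (intro elementary_move_fixed) auto
    then show False using triangle_trivial[OF assms(1-3), of b] d by simp
  qed
  then obtain l where l: "l \<in># B" "{a, b, c} \<subseteq> l" by auto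
  obtain w where "l = {a, b, c, w}" "w \<noteq> a" "w \<noteq> b" "w \<noteq> c"
    by (rule card_4_witness[OF card_line[OF l(1)], of a b c]) (use l d in auto)
  then show thesis using that[of w] l d by auto
qed

lemma elementary_move_fixed_noncollinear:
  assumes "\<not> (col z x \<and> col z y)" "z \<noteq> x" "z \<noteq> y"
  shows "em x y z = z"
  using assms line_collinear by (intro elementary_move_fixed) auto

text \<open>If \<open>c\<close> were not collinear with \<open>a\<close>, the first two steps of the closed walk
  \<open>b, a, x, b\<close> would fix \<open>c\<close> and the third would move it.\<close>

lemma collinear_common_edge:
  assumes cols: "col b a" "col a x" "col x b" "col c x" "col c b"
    and d: "distinct [a, b, x]"
  shows "col a c"
proof (rule ccontr)
  assume n: "\<not> col a c"
  then have cb: "c \<noteq> a" "c \<noteq> b" "c \<noteq> x" using cols collinear_sym by (auto simp: collinear_def)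
  obtain w where w: "{x, b, c, w} \<in># B" "distinct [x, b, c, w]"
    by (rule triangle_line[of x b c]) (use cols cb d collinear_sym in auto)
  have "\<not> col c a" using n collinear_sym[of \<Omega> B c a] by auto
  then have "em b a c = c" "em a x c = c"
    using cb by (auto intro: elementary_move_fixed_noncollinear)
  then have "em x b c = c" using triangle_trivial[OF cols(1-3), of c] by simp
  then show False using elementary_move_line[OF w] w by auto
qed

text \<open>On a closed walk \<open>b, a, \<dots>, c, b\<close> whose inner points are not collinear with \<open>b\<close>,
  the point \<open>a\<close> is moved to \<open>b\<close>, stays there, and ends at \<open>c\<close>. Any inner point collinear
  with \<open>b\<close> splits the walk into shorter ones.\<close>

lemma neighbours_collinear:
  assumes "collinear_walk \<Omega> B a c xs" "b \<notin> set xs" "col b a" "col b c"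
  shows "col a c"
  using assms
proof (induction "length xs" arbitrary: a c xs rule: less_induct)
  case less
  have walk: "xs \<noteq> []" "hd xs = a" "last xs = c" "set xs \<subseteq> \<Omega>" "successively col xs"
    using less.prems by (auto simp: collinear_walk_def)
  show ?case
  proof (cases "\<exists>ys x zs. xs = ys @ x # zs \<and> ys \<noteq> [] \<and> zs \<noteq> [] \<and> col b x")
    case True
    then obtain ys x zs where split: "xs = ys @ x # zs" "ys \<noteq> []" "zs \<noteq> []" "col b x" by blast
    have "successively col (ys @ [x])" "successively col (x # zs)"
      using walk(5) split by (auto simp: successively_append_iff)
    then have "collinear_walk \<Omega> B a x (ys @ [x])" "collinear_walk \<Omega> B x c (x # zs)"
      using walk split by (auto simp: collinear_walk_def)
    \<comment> \<open>Since \<open>ys\<close> and \<open>zs\<close> are nonempty, both pieces are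
      shorter than \<open>xs\<close> and the induction hypothesis applies.\<close>
    then have ax: "col a x" and xc: "col x c"
      using less.hyps[of "ys @ [x]" a x] less.hyps[of "x # zs" x c] less.prems split by auto
    show ?thesis
    proof (cases "a = x")
      case False
      have "a \<noteq> b" "x \<noteq> b" using less.prems walk split by auto
      then show ?thesis
        using False ax xc less.prems split collinear_sym
        by (intro collinear_common_edge[of b a x c]) auto
    qed (use xc in simp)
  next
    case False
    show ?thesis
    proof (cases "length xs \<le> 2")
      case True
      then consider "xs = [a]" "c = a" | "xs = [a, c]"
        using walk(1-3) by (cases xs; cases "tl xs") auto
      then show ?thesis using walk less.prems by cases (auto simp: collinear_def)
    next
      case long: False
      then obtain m ms where xs: "xs = a # m # ms @ [c]"
        using walk(1-3) by (cases xs; cases "tl xs"; cases "tl (tl xs)" rule: rev_cases) auto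
      have inner: "\<not> col b x" if x: "x \<in> set (m # ms)" for x
      proof -
        obtain us vs where "m # ms = us @ x # vs" using split_list[OF x] by blast
        then have "xs = (a # us) @ x # (vs @ [c])" using xs by simp
        then show ?thesis using False by blast
      qed
      \<comment> \<open>Every edge of this walk has an inner end, which is not collinear with
        \<open>b\<close>, so no elementary move along the walk moves \<open>b\<close>.\<close>
      have fix_b: "em u v b = b" if "u \<in> set (m # ms) \<or> v \<in> set (m # ms)" "u \<noteq> b" "v \<noteq> b" for u v
        using that inner by (intro elementary_move_fixed_noncollinear) auto
      have b: "a \<noteq> b" "c \<noteq> b" "b \<notin> set (m # ms)" using less.prems xs by auto
      have "successively (\<lambda>u v. em u v b = b) (n # ns @ [c])"
        if "set (n # ns) \<subseteq> set (m # ms)" for n ns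
        using that
      proof (induction ns arbitrary: n)
        case Nil
        then show ?case using fix_b[of n c] b by auto
      next
        case (Cons n' ns)
        then have "em n n' b = b" using b by (intro fix_b) auto
        then show ?case using Cons by simp
      qed
      from this[of m ms] have "successively (\<lambda>u v. em u v b = b) xs"
        using fix_b[of a m] b xs by auto
      then have "move_sequence B xs b = b" by (rule move_sequence_fixed)
      moreover have "move_sequence B (b # xs @ [b]) = em c b \<circ> move_sequence B xs \<circ> em b a"
        using move_sequence_append[of B "a # m # ms" c "[b]"] xs by (simp add: comp_assoc)
      moreover have "collinear_walk \<Omega> B b b (b # xs @ [b])"
        using walk less.prems collinear_sym
        by (auto simp: collinear_walk_def successively_append_iff successively_Cons collinear_def)
      ultimately have "c = a"
        using closed_walk_trivial by (metis comp_apply elementary_move_left elementary_move_right id_apply)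
      \<comment> \<open>In this case the two ends coincide, and collinearity is reflexive.\<close>
      then show ?thesis using walk by (auto simp: collinear_def)
    qed
  qed
qed

end

section \<open>The group structure when all points are collinear\<close>

locale complete_trivial_stabilizers = trivial_stabilizers +
  assumes complete: "\<lbrakk>x \<in> \<Omega>; y \<in> \<Omega>\<rbrakk> \<Longrightarrow> col x y"
begin

text \<open>All triples are now triangles, so \<open>triangle_line\<close> and pliability make the
  lines a Steiner quadruple system, in which \<open>em\<close> computes the fourth point.\<close>

lemma fourth_point:
  assumes "x \<in> \<Omega>" "y \<in> \<Omega>" "z \<in> \<Omega>" "distinct [x, y, z]"
  shows "{x, y, z, em x y z} \<in># B" "distinct [x, y, z, em x y z]"
proof -
  obtain w where "{x, y, z, w} \<in># B" "distinct [x, y, z, w]"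
    by (rule triangle_line[of x y z]) (use assms complete in auto)
  moreover from this have "em x y z = w" by (rule elementary_move_line)
  ultimately show "{x, y, z, em x y z} \<in># B" "distinct [x, y, z, em x y z]" by simp_all
qed

text \<open>The fourth point depends only on the set of the other three; repeated points are settled
  by evaluating the moves.\<close>

lemma elementary_move_symmetric:
  assumes "x \<in> \<Omega>" "y \<in> \<Omega>" "z \<in> \<Omega>"
  shows "em y x z = em x y z" "em x z y = em x y z"
proof -
  have "em y x z = em x y z \<and> em x z y = em x y z"
  proof (cases "distinct [x, y, z]")
    case True
    note w = fourth_point[OF assms True]
    then have "{y, x, z, em x y z} \<in># B" "{x, z, y, em x y z} \<in># B"
      by (simp_all add: insert_commute)
    then show ?thesis using w(2) by (auto intro!: elementary_move_line)
  qed auto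
  then show "em y x z = em x y z" "em x z y = em x y z" by simp_all
qed

lemma elementary_move_closed:
  assumes "x \<in> \<Omega>" "y \<in> \<Omega>" "z \<in> \<Omega>"
  shows "em x y z \<in> \<Omega>"
proof (cases "distinct [x, y, z]")
  case True
  then show ?thesis using line_subset[OF fourth_point(1)[OF assms]] by simp
qed (use assms in auto)

text \<open>The closed walk \<open>x, y, x\<close> is read as the triangle
  \<open>x, y, y, x\<close>, whose middle move is the identity.\<close>

lemma elementary_move_involution:
  assumes "x \<in> \<Omega>" "y \<in> \<Omega>" "z \<in> \<Omega>"
  shows "em x y (em x y z) = z"
  using triangle_trivial[of x y y z] complete assms
    elementary_move_symmetric(1)[of x y "em x y z"] elementary_move_closed by simp

text \<open>The walk \<open>e, x, y, e\<close>, evaluated at \<open>em e x z\<close>, gives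
  \<open>em e y (em x y z) = em e x z\<close>, and \<open>em e y\<close> is its own inverse.\<close>

lemma elementary_move_translate:
  assumes "e \<in> \<Omega>" "x \<in> \<Omega>" "y \<in> \<Omega>" "z \<in> \<Omega>"
  shows "em e y (em e x z) = em x y z"
proof -
  have "em x y z = em e y (em e y (em x y z))"
    using assms elementary_move_closed elementary_move_involution by simp
  also have "em e y (em x y z) = em e x z"
    using triangle_trivial[of e x y "em e x z"] complete assms elementary_move_closed
      elementary_move_involution elementary_move_symmetric(1)[of e y "em x y z"] by simp
  finally show ?thesis by simp
qed

lemma elementary_abelian_2_group:
  assumes e: "e \<in> \<Omega>"
  shows "elementary_abelian_2_group \<Omega> (em e) e"
proof
  \<comment> \<open>By translation both sides equal \<open>em x y z\<close>, up to exchanging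
    \<open>x\<close> and \<open>y\<close>.\<close>
  show "em e x (em e y z) = em e y (em e x z)" if "x \<in> \<Omega>" "y \<in> \<Omega>" "z \<in> \<Omega>" for x y z
    using that e elementary_move_translate elementary_move_symmetric(1)[of x y z] by simp
  show "em e x y = em e y x" if "x \<in> \<Omega>" "y \<in> \<Omega>" for x y
    using that e elementary_move_symmetric(2) by simp
qed (use e finite_points elementary_move_closed in auto)

lemma line_iff_sum:
  assumes e: "e \<in> \<Omega>" and xyzw: "{x, y, z, w} \<subseteq> \<Omega>" and d: "distinct [x, y, z, w]"
  shows "{x, y, z, w} \<in># B \<longleftrightarrow> w = em e x (em e y z)"
proof -
  have "em e x (em e y z) = em x y z"
    using xyzw e elementary_move_translate[of e y x z] elementary_move_symmetric(1)[of x y z] by simp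
  moreover have "{x, y, z, w} \<in># B \<longleftrightarrow> w = em x y z"
    using elementary_move_line[OF _ d] fourth_point(1)[of x y z] xyzw d by auto
  ultimately show ?thesis by simp
qed

end

section \<open>From the group structure to a Boolean system\<close>

context pliable_hypergraph
begin

text \<open>Coordinates turn the line condition into a vanishing sum of vectors. The addition is
  kept general because two-point sets and the complete case supply different groups.\<close>

lemma boolean_if_group:
  assumes group: "elementary_abelian_2_group \<Omega> add e"
    and card: "card \<Omega> \<ge> 2"
    and line_iff: "\<And>x y z w. \<lbrakk>{x, y, z, w} \<subseteq> \<Omega>; distinct [x, y, z, w]\<rbrakk> \<Longrightarrow>
      {x, y, z, w} \<in># B \<longleftrightarrow> w = add x (add y z)"
  shows "\<exists>k>0. is_boolean_quadruple_system k \<Omega> B"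
proof -
  interpret elementary_abelian_2_group \<Omega> add e by (rule group)
  obtain \<phi> k where bij: "bij_betw \<phi> \<Omega> (F2_vectors k)"
    and hom: "\<forall>x\<in>\<Omega>. \<forall>y\<in>\<Omega>. \<phi> (add x y) = (\<lambda>i. \<phi> x i + \<phi> y i)"
    by (rule coordinates)
  have "\<forall>l. l \<subseteq> \<Omega> \<longrightarrow> card l = 4 \<longrightarrow> (l \<in># B \<longleftrightarrow> (\<forall>i. (\<Sum>v\<in>l. \<phi> v i) = 0))"
  proof (intro allI impI)
    fix l assume l: "l \<subseteq> \<Omega>" "card l = 4"
    then obtain x y z w where xyzw: "l = {x, y, z, w}" "distinct [x, y, z, w]"
      using card_4_obtain by metis
    then have mem: "x \<in> \<Omega>" "y \<in> \<Omega>" "z \<in> \<Omega>" "w \<in> \<Omega>" using l by auto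
    have "(\<Sum>v\<in>l. \<phi> v i) = \<phi> x i + (\<phi> y i + (\<phi> z i + \<phi> w i))" for i
      using xyzw by simp
    moreover have "\<phi> (add x (add y z)) = (\<lambda>i. \<phi> x i + \<phi> y i + \<phi> z i)"
      using mem closed by (simp add: hom add.assoc)
    ultimately have "(\<forall>i. (\<Sum>v\<in>l. \<phi> v i) = 0) \<longleftrightarrow> \<phi> w = \<phi> (add x (add y z))"
      by (simp only: bit_sum_eq_0_iff fun_eq_iff)
    also have "\<dots> \<longleftrightarrow> w = add x (add y z)"
      using bij mem closed by (auto simp: bij_betw_def inj_on_eq_iff)
    also have "\<dots> \<longleftrightarrow> l \<in># B" using line_iff[of x y z w] xyzw mem by simp
    finally show "l \<in># B \<longleftrightarrow> (\<forall>i. (\<Sum>v\<in>l. \<phi> v i) = 0)" by simp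
  qed
  then have "is_boolean_quadruple_system k \<Omega> B"
    unfolding is_boolean_quadruple_system_def using bij boolean_iff_lines[OF bij] by blast
  moreover have "k > 0"
  proof (rule ccontr)
    assume "\<not> k > 0"
    then have "card \<Omega> = 1" using bij_betw_same_card[OF bij] by (simp add: F2_vectors_0)
    then show False using card by simp
  qed
  ultimately show ?thesis by blast
qed

lemma boolean_if_two_points:
  assumes "card \<Omega> = 2"
  shows "\<exists>k>0. is_boolean_quadruple_system k \<Omega> B"
proof -
  obtain a b where ab: "\<Omega> = {a, b}" "a \<noteq> b" using assms by (auto simp: card_2_iff)
  \<comment> \<open>This is the group of order two with zero \<open>a\<close>. Two points contain no
    4-set, so the line condition holds vacuously.\<close>
  have "elementary_abelian_2_group \<Omega> (\<lambda>x y. if x = y then a else b) a"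
    using ab by unfold_locales (auto split: if_splits)
  then show ?thesis
    by (rule boolean_if_group) (use ab assms in auto)
qed

end

section \<open>Transitivity of collinearity and the equivalence\<close>

context trivial_stabilizers
begin

text \<open>As \<open>b\<close> is not a cut point, its neighbours \<open>a\<close> and
  \<open>c\<close> are joined by a walk avoiding it, as \<open>neighbours_collinear\<close>
  demands.\<close>

lemma collinear_trans:
  assumes no_cut: "no_cut_point \<Omega> B" and "col a b" "col b c"
  shows "col a c"
proof (cases "a = b \<or> c = b")
  case False
  have "a \<in> \<Omega>" "b \<in> \<Omega>" "c \<in> \<Omega>" using assms by (auto simp: collinear_def)
  then obtain xs where "collinear_walk \<Omega> B a c xs" "b \<notin> set xs"
    using no_cut False unfolding no_cut_point_def by blast
  then show ?thesis by (rule neighbours_collinear) (use assms collinear_sym in auto)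
qed (use assms in auto)

lemma walk_collinear:
  assumes "no_cut_point \<Omega> B" "successively col xs" "xs \<noteq> []" "set xs \<subseteq> \<Omega>"
  shows "col (hd xs) (last xs)"
  using assms(2-)
proof (induction xs rule: induct_list012)
  case (3 x y xs)
  then show ?case using collinear_trans[OF assms(1), of x y] by simp
qed (auto simp: collinear_def)

text \<open>Deleting a third point \<open>p\<close> yields a walk from \<open>x\<close> to
  \<open>y\<close>, and transitivity along it makes its ends collinear.\<close>

lemma all_collinear:
  assumes no_cut: "no_cut_point \<Omega> B" and card: "card \<Omega> \<ge> 3" and xy: "x \<in> \<Omega>" "y \<in> \<Omega>"
  shows "col x y"
proof -
  have "card {x, y} \<le> 2" by (simp add: card_insert_if)
  then have "\<not> \<Omega> \<subseteq> {x, y}" using card card_mono[of "{x, y}" \<Omega>] by fastforce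
  then obtain p where "p \<in> \<Omega>" "p \<noteq> x" "p \<noteq> y" by blast
  then obtain xs where "collinear_walk \<Omega> B x y xs"
    using no_cut xy unfolding no_cut_point_def by (metis Diff_iff singletonD)
  then show ?thesis using walk_collinear[OF no_cut, of xs] by (auto simp: collinear_walk_def)
qed

lemma boolean_quadruple_system:
  assumes no_cut: "no_cut_point \<Omega> B" and card: "card \<Omega> \<ge> 2"
  shows "\<exists>k>0. is_boolean_quadruple_system k \<Omega> B"
\<comment> \<open>Two points carry no line and are not collinear, so this case cannot pass through
  completeness.\<close>
proof (cases "card \<Omega> = 2")
  case False
  then have "card \<Omega> \<ge> 3" using card by simp
  then interpret complete_trivial_stabilizers \<Omega> B
    by unfold_locales (rule all_collinear[OF no_cut])
  obtain e where e: "e \<in> \<Omega>" using card by fastforce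
  show ?thesis
    by (rule boolean_if_group[OF elementary_abelian_2_group[OF e] card line_iff_sum[OF e]])
qed (rule boolean_if_two_points)

end

theorem theoremB:
  fixes \<Omega> :: "'a set" and B :: "'a set multiset"
  assumes "four_hypergraph \<Omega> B"
    and "simple_lines B"
    and "pliable B"
    and "card \<Omega> \<ge> 2"
    and "no_cut_point \<Omega> B"
  shows "(\<forall>p\<in>\<Omega>. hole_stabilizer \<Omega> B p = {id})
     \<longleftrightarrow> (\<exists>k>0. is_boolean_quadruple_system k \<Omega> B)"
proof
  interpret pliable_hypergraph \<Omega> B using assms(1-3) by unfold_locales
  {
    assume "\<forall>p\<in>\<Omega>. hole_stabilizer \<Omega> B p = {id}"
    then interpret trivial_stabilizers \<Omega> B by unfold_locales blast
    show "\<exists>k>0. is_boolean_quadruple_system k \<Omega> B"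
      by (rule boolean_quadruple_system[OF assms(5,4)])
  next
    assume "\<exists>k>0. is_boolean_quadruple_system k \<Omega> B"
    then show "\<forall>p\<in>\<Omega>. hole_stabilizer \<Omega> B p = {id}" using boolean_hole_stabilizer by blast
  }
qed

end
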